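(* For $n\ge2$ let $Q_n(\beta)$ be the specialization $x_{ij}=1$ (for all $i,j$) of the reduced polynomial of the element $w_0^{(n)}=\prod_{1\le i<j\le n}x_{ij}$. Then $$Q_n(\beta-1)=\left(\sum_{m\ge0}\iota(\mathcal{CRY}_{n+1},m)\,\beta^m\right)(1-\beta)^{\binom{n+1}{2}+1},$$ where $\mathcal{CRY}_N$ denotes the Chan–Robbins–Yuen polytope, i.e. the convex polytope of $N\times N$ matrices $(a_{ij})$ with non-negative entries such that (1) $\sum_ia_{ij}=1$ for all $j$ and $\sum_ja_{ij}=1$ for all $i$; (2) $a_{ij}=0$ if $j>i+1$. Here, for an integral convex polytope $\mathcal{P}\subset\mathbb{R}^d$, $\iota(\mathcal{P},m)$ is the number of integer points in $m\mathcal{P}$.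
   Context: Reduced polynomial: work in the commutative polynomial ring in variables $x_{ij}$, $1\le i<j\le n$, over $\mathbb{Z}[\beta]$, and, starting from $\prod_{i<j}x_{ij}$, repeatedly replace (in any monomial) a product $x_{ij}x_{jk}$ with $i<j<k$ by $x_{ik}x_{ij}+x_{jk}x_{ik}+\beta x_{ik}$, in any order, until no monomial contains such a product. The resulting polynomial $Q_n(x_{ij};\beta)$ may depend on the order of the replacements; $Q_n(\beta)$ is its value at $x_{ij}=1$ for all $i<j$ (this value does not depend on the order). *)

theory Defs
  imports
    "HOL-Library.Poly_Mapping"
    "HOL-Computational_Algebra.Polynomial_FPS"
    "Jordan_Normal_Form.Matrix"
begin

text \<open>
  The pair \<open>(i, j)\<close> indexes the variable \<open>x_ij\<close>. A monomial is an exponent function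
  \<open>(nat \<times> nat) \<Rightarrow>\<^sub>0 nat\<close>, and the coefficient ring \<open>int poly\<close> is the ring of integer
  polynomials in \<open>\<beta>\<close>. The variables that occur below all satisfy \<open>i < j\<close>.
\<close>

type_synonym xmonom = "(nat \<times> nat) \<Rightarrow>\<^sub>0 nat"
type_synonym xpoly = "xmonom \<Rightarrow>\<^sub>0 int poly"

definition xvar :: "nat \<Rightarrow> nat \<Rightarrow> xpoly" where
  "xvar i j = Poly_Mapping.single (Poly_Mapping.single (i, j) 1) 1"

definition xconst :: "int poly \<Rightarrow> xpoly" where
  "xconst c = Poly_Mapping.single 0 c"

definition beta :: xpoly where
  "beta = xconst [:0, 1:]"

definition w0 :: "nat \<Rightarrow> xpoly" where
  "w0 n = (\<Prod>(i, j) \<in> {(i, j). 1 \<le> i \<and> i < j \<and> j \<le> n}. xvar i j)"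

text \<open>
  One replacement: a monomial \<open>m = m' x_ij x_jk\<close> occurring in \<open>p\<close> is replaced, together with
  its full coefficient \<open>c\<close>. The monomial \<open>m'\<close> may still be divisible by \<open>x_ij\<close>, \<open>x_jk\<close>.
\<close>

inductive reduction_step :: "xpoly \<Rightarrow> xpoly \<Rightarrow> bool" where
  "\<lbrakk>i < j; j < k; m \<in> Poly_Mapping.keys p; c = Poly_Mapping.lookup p m;
    m = m' + Poly_Mapping.single (i, j) 1 + Poly_Mapping.single (j, k) 1\<rbrakk>
   \<Longrightarrow> reduction_step p
        (p - Poly_Mapping.single m c
           + Poly_Mapping.single m' c
             * (xvar i k * xvar i j + xvar j k * xvar i k + beta * xvar i k))"

definition is_reduced :: "xpoly \<Rightarrow> bool" where
  "is_reduced p \<longleftrightarrow>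
     \<not> (\<exists>m \<in> Poly_Mapping.keys p. \<exists>i j k m'. i < j \<and> j < k \<and>
          m = m' + Poly_Mapping.single (i, j) 1 + Poly_Mapping.single (j, k) 1)"

text \<open>A polynomial may have several reduced polynomials, depending on the order of replacements.\<close>

definition reduced_polynomial_of :: "xpoly \<Rightarrow> xpoly \<Rightarrow> bool" where
  "reduced_polynomial_of p q \<longleftrightarrow> reduction_step\<^sup>*\<^sup>* p q \<and> is_reduced q"

definition eval_xpoly :: "(nat \<times> nat \<Rightarrow> int poly) \<Rightarrow> xpoly \<Rightarrow> int poly" where
  "eval_xpoly f p = (\<Sum>m \<in> Poly_Mapping.keys p. Poly_Mapping.lookup p m *
     (\<Prod>v \<in> Poly_Mapping.keys m. f v ^ Poly_Mapping.lookup m v))"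

text \<open>
  Matrix indices are 0-based. This does not affect the condition \<open>j > i + 1\<close>, which is
  invariant under shifting both indices.
\<close>

definition CRY :: "nat \<Rightarrow> real mat set" where
  "CRY N = {A \<in> carrier_mat N N.
     (\<forall>i<N. \<forall>j<N. A $$ (i, j) \<ge> 0) \<and>
     (\<forall>j<N. (\<Sum>i<N. A $$ (i, j)) = 1) \<and>
     (\<forall>i<N. (\<Sum>j<N. A $$ (i, j)) = 1) \<and>
     (\<forall>i<N. \<forall>j<N. j > i + 1 \<longrightarrow> A $$ (i, j) = 0)}"

text \<open>
  Number of integer points in the dilate \<open>m P\<close>. It is meaningful for bounded \<open>P\<close> consisting of
  matrices of one fixed dimension; \<open>card\<close> is 0 on infinite sets.
\<close>

definition ehrhart_count :: "real mat set \<Rightarrow> nat \<Rightarrow> nat" where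
  "ehrhart_count P m = card {B \<in> (\<lambda>A. real m \<cdot>\<^sub>m A) ` P. elements_mat B \<subseteq> \<int>}"

end

theory Submission
  imports Defs
begin

text \<open>
  Read a monomial \<open>m\<close> as a directed multigraph with arcs \<open>i \<rightarrow> j\<close> for each factor \<open>x_ij\<close>. A flow
  assigns a natural number to every arc; \<open>net f v\<close> is what leaves the vertex \<open>v\<close> minus what enters it,
  and the excess of \<open>f\<close> is the sum of the positive parts of these numbers, that is, the least amount
  that must be fed into the graph from outside. Let \<open>t = \<beta> + 1\<close> and let \<open>\<Phi>(m)\<close> be
  \<open>(1 - t)^e \<Sum>\<^sub>f t^(excess f)\<close>, where \<open>e\<close> is the number of arcs of \<open>m\<close>. Three properties of
  \<open>\<Phi>\<close> carry the proof.

  First, \<open>\<Phi>\<close> respects the reduction relation (\<open>weighted_flow_series_reduction\<close>). Let the arcs \<open>i \<rightarrow> j\<close>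
  and \<open>j \<rightarrow> k\<close> carry \<open>p\<close> and \<open>q\<close>. Rerouting \<open>min p q\<close> units along a new arc \<open>i \<rightarrow> k\<close> changes no net
  value and empties one of the two old arcs, which may then be dropped. The flows with \<open>p \<ge> q\<close> become
  those of the graph with arcs \<open>ik, ij\<close>, the flows with \<open>p \<le> q\<close> those with \<open>jk, ik\<close>, and the doubly
  counted flows with \<open>p = q\<close> those with \<open>ik\<close> only. The last graph has one arc less than the others, so
  the subtracted term acquires the factor \<open>1 - t = - \<beta>\<close>, which produces the sign and the \<open>\<beta>\<close> of the
  relation.

  Second, \<open>\<Phi>(m) = 1\<close> if \<open>m\<close> is reduced (\<open>weighted_flow_series_reduced\<close>). Then every vertex only emits
  or only receives, so the excess is the sum of all the values of the flow, and the \<open>e\<close> values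
  contribute independent geometric series. Hence the linear extension of \<open>\<Phi>\<close> maps a reduced polynomial
  to its value at \<open>x_ij = 1\<close>, written in \<open>t\<close>, and that value is \<open>\<Phi>\<close> of the starting monomial, whatever the
  order of the replacements.

  Third, for the complete graph on \<open>n\<close> vertices \<open>\<Phi>\<close> is the Ehrhart series of the
  Chan-Robbins-Yuen polytope up to a power of \<open>1 - t\<close> (\<open>ehrhart_series_CRY\<close>). An integer point of the
  \<open>d\<close>-th dilate is a flow of total value \<open>d\<close> on the complete graph with an added source and sink:
  entries on and below the diagonal are the values on arcs, superdiagonal entries are slacks. Such a
  flow is determined by its restriction \<open>f\<close> to the inner arcs together with \<open>n + 1\<close> free
  numbers: the amount that passes straight from the source through a vertex to the sink, for each
  of the \<open>n\<close> inner vertices, and the amount on the arc from the source to the sink. Its total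
  value is the excess of \<open>f\<close> plus the sum of these numbers, so they contribute
  \<open>(1 - t)^(- n - 1)\<close>, and \<open>binomial n 2 + n + 1 = binomial (n + 1) 2 + 1\<close>.

  A reduced polynomial exists because each replacement lengthens an arc or removes one, which makes
  a suitable potential decrease (\<open>potential_decreases\<close>).
\<close>

section \<open>Counting series\<close>

definition weight_series :: "'a set \<Rightarrow> ('a \<Rightarrow> nat) \<Rightarrow> int fps" where
  "weight_series X w = Abs_fps (\<lambda>d. int (card {x \<in> X. w x = d}))"

definition finite_fibres :: "'a set \<Rightarrow> ('a \<Rightarrow> nat) \<Rightarrow> bool" where
  "finite_fibres X w \<longleftrightarrow> (\<forall>d. finite {x \<in> X. w x = d})"

definition supported_on :: "'e set \<Rightarrow> ('e \<Rightarrow> nat) set" where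
  "supported_on I = {r. \<forall>e. e \<notin> I \<longrightarrow> r e = 0}"

lemma weight_series_bij:
  assumes "bij_betw h X Y" and "\<And>x. x \<in> X \<Longrightarrow> w' (h x) = w x"
  shows "weight_series X w = weight_series Y w'"
proof -
  have "card {x \<in> X. w x = d} = card {y \<in> Y. w' y = d}" for d
  proof (rule bij_betw_same_card)
    show "bij_betw h {x \<in> X. w x = d} {y \<in> Y. w' y = d}"
      using assms unfolding bij_betw_def inj_on_def by (auto simp: image_iff)
  qed
  then show ?thesis by (simp add: weight_series_def)
qed

lemma finite_fibres_bij:
  assumes "bij_betw h X Y" and "\<And>x. x \<in> X \<Longrightarrow> w' (h x) = w x" and "finite_fibres Y w'"
  shows "finite_fibres X w"
  unfolding finite_fibres_def
proof
  fix d
  have "bij_betw h {x \<in> X. w x = d} {y \<in> Y. w' y = d}"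
    using assms(1,2) unfolding bij_betw_def inj_on_def by (auto simp: image_iff)
  then show "finite {x \<in> X. w x = d}"
    using assms(3) by (simp add: bij_betw_finite finite_fibres_def)
qed

lemma weight_series_inclusion_exclusion:
  assumes "finite_fibres X w" and "\<And>x. x \<in> X \<Longrightarrow> P x \<or> Q x"
  shows "weight_series X w + weight_series {x \<in> X. P x \<and> Q x} w
    = weight_series {x \<in> X. P x} w + weight_series {x \<in> X. Q x} w"
proof -
  have "card {x \<in> X. w x = d} + card {x \<in> {x \<in> X. P x \<and> Q x}. w x = d}
    = card {x \<in> {x \<in> X. P x}. w x = d} + card {x \<in> {x \<in> X. Q x}. w x = d}" for d
  proof -
    let ?A = "{x \<in> {x \<in> X. P x}. w x = d}" and ?B = "{x \<in> {x \<in> X. Q x}. w x = d}"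
    have fin: "finite {x \<in> X. w x = d}" using assms(1) by (simp add: finite_fibres_def)
    have "finite ?A" "finite ?B" by (rule finite_subset[OF _ fin], auto)+
    moreover have "?A \<union> ?B = {x \<in> X. w x = d}" using assms(2) by auto
    moreover have "?A \<inter> ?B = {x \<in> {x \<in> X. P x \<and> Q x}. w x = d}" by auto
    ultimately show ?thesis using card_Un_Int[of ?A ?B] by simp
  qed
  then show ?thesis
    by (simp add: weight_series_def fps_eq_iff flip: of_nat_add)
qed

lemma finite_fibres_prod_supported_on:
  assumes "finite_fibres X w" and "finite I"
  shows "finite_fibres (X \<times> supported_on I) (\<lambda>(x, r). w x + (\<Sum>i\<in>I. r i))"
  unfolding finite_fibres_def
proof
  fix d
  let ?R = "{r. \<forall>i. (i \<in> I \<longrightarrow> r i \<in> {..d}) \<and> (i \<notin> I \<longrightarrow> r i = (0::nat))}"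
  have le: "r i \<le> (\<Sum>i\<in>I. r i)" if "i \<in> I" for r :: "'b \<Rightarrow> nat" and i
    using that assms(2) by (simp add: member_le_sum)
  have "{p \<in> X \<times> supported_on I. (case p of (x, r) \<Rightarrow> w x + (\<Sum>i\<in>I. r i)) = d}
    \<subseteq> (\<Union>e\<le>d. {x \<in> X. w x = e}) \<times> ?R"
    using le by (auto simp: supported_on_def intro: order_trans trans_le_add2)
  moreover have "finite ((\<Union>e\<le>d. {x \<in> X. w x = e}) \<times> ?R)"
    using assms by (intro finite_cartesian_product finite_UN_I finite_set_of_finite_funs)
      (auto simp: finite_fibres_def)
  ultimately show "finite {p \<in> X \<times> supported_on I. (case p of (x, r) \<Rightarrow> w x + (\<Sum>i\<in>I. r i)) = d}"
    by (rule finite_subset)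
qed

text \<open>
  Multiplication by \<open>1 - X\<close> takes differences of consecutive coefficients. The pairs of total
  weight \<open>d\<close> with \<open>k > 0\<close> correspond to all pairs of total weight \<open>d - 1\<close>, so only \<open>k = 0\<close> survives.
\<close>

lemma weight_series_prod_nat:
  assumes "finite_fibres X w"
  shows "weight_series (X \<times> UNIV) (\<lambda>(x, k). w x + k) * (1 - fps_X) = weight_series X w"
proof (rule fps_ext)
  fix d
  let ?F = "\<lambda>d. {p \<in> X \<times> (UNIV :: nat set). (case p of (x, k) \<Rightarrow> w x + k) = d}"
  have fin: "finite (?F d)" for d
  proof (rule finite_subset)
    show "?F d \<subseteq> (\<Union>e\<le>d. {x \<in> X. w x = e}) \<times> {..d}" by auto
    show "finite ((\<Union>e\<le>d. {x \<in> X. w x = e}) \<times> {..d})"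
      using assms by (auto simp: finite_fibres_def)
  qed
  have coeff: "fps_nth (A * (1 - fps_X)) d = fps_nth A d - (if d = 0 then 0 else fps_nth A (d - 1))"
    for A :: "int fps" and d by (simp add: right_diff_distrib)
  show "fps_nth (weight_series (X \<times> UNIV) (\<lambda>(x, k). w x + k) * (1 - fps_X)) d
    = fps_nth (weight_series X w) d"
  proof (cases d)
    case 0
    have "?F 0 = (\<lambda>x. (x, 0)) ` {x \<in> X. w x = 0}" by auto
    then have "card (?F 0) = card {x \<in> X. w x = 0}" by (simp add: card_image inj_on_def)
    with 0 show ?thesis by (simp add: coeff weight_series_def)
  next
    case (Suc e)
    let ?A = "(\<lambda>(x, k). (x, Suc k)) ` ?F e" and ?B = "(\<lambda>x. (x, 0::nat)) ` {x \<in> X. w x = d}"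
    have "?F d = ?A \<union> ?B"
    proof (intro equalityI subsetI)
      fix p assume p: "p \<in> ?F d"
      obtain x k where "p = (x, k)" by (cases p)
      with p Suc show "p \<in> ?A \<union> ?B" by (cases k) (auto simp: image_iff)
    qed (auto simp: Suc)
    moreover have "card (?A \<union> ?B) = card ?A + card ?B"
      using fin[of e] assms by (intro card_Un_disjoint) (auto simp: finite_fibres_def)
    moreover have "card ?A = card (?F e)" by (intro card_image) (auto simp: inj_on_def)
    moreover have "card ?B = card {x \<in> X. w x = d}" by (intro card_image) (auto simp: inj_on_def)
    ultimately show ?thesis using Suc by (simp add: coeff weight_series_def)
  qed
qed

text \<open>
  Each free natural number contributes a geometric series. This one fact is used twice: for the values
  of a flow on a reduced graph, and for the amounts that pass straight through the vertices of
  the complete graph.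
\<close>

lemma weight_series_prod_supported_on:
  assumes "finite_fibres X w" and "finite I"
  shows "weight_series (X \<times> supported_on I) (\<lambda>(x, r). w x + (\<Sum>i\<in>I. r i)) * (1 - fps_X) ^ card I
    = weight_series X w"
  using assms(2)
proof (induction I rule: finite_induct)
  case empty
  have "bij_betw fst (X \<times> supported_on {}) X"
    by (auto simp: bij_betw_def inj_on_def supported_on_def image_iff)
  then show ?case
    by (auto intro: weight_series_bij)
next
  case (insert i I)
  let ?h = "\<lambda>((x, r), k). (x, r(i := k))"
  let ?w = "\<lambda>(x, r). w x + (\<Sum>i\<in>I. r i)"
  have bij: "bij_betw ?h ((X \<times> supported_on I) \<times> UNIV) (X \<times> supported_on (insert i I))"
    using insert.hyps
    by (intro bij_betw_byWitness[where f' = "\<lambda>(x, r). ((x, r(i := 0)), r i)"])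
      (auto simp: supported_on_def fun_eq_iff)
  have "weight_series (X \<times> supported_on (insert i I)) (\<lambda>(x, r). w x + (\<Sum>i\<in>insert i I. r i))
    = weight_series ((X \<times> supported_on I) \<times> UNIV) (\<lambda>(p, k). ?w p + k)"
  proof (rule sym, rule weight_series_bij[OF bij])
    fix p assume "p \<in> (X \<times> supported_on I) \<times> (UNIV :: nat set)"
    obtain x r k where p: "p = ((x, r), k)" by (metis surj_pair)
    have "(\<Sum>a\<in>I. (r(i := k)) a) = (\<Sum>a\<in>I. r a)"
      using insert.hyps by (intro sum.cong) auto
    then show "(case ?h p of (x, r) \<Rightarrow> w x + (\<Sum>i\<in>insert i I. r i)) = (case p of (p, k) \<Rightarrow> ?w p + k)"
      using insert.hyps by (simp add: p)
  qed
  then have "weight_series (X \<times> supported_on (insert i I)) (\<lambda>(x, r). w x + (\<Sum>i\<in>insert i I. r i))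
      * (1 - fps_X) ^ card (insert i I)
    = weight_series ((X \<times> supported_on I) \<times> UNIV) (\<lambda>(p, k). ?w p + k) * (1 - fps_X)
      * (1 - fps_X) ^ card I"
    using insert.hyps by (simp add: mult.assoc)
  also have "\<dots> = weight_series (X \<times> supported_on I) ?w * (1 - fps_X) ^ card I"
    using weight_series_prod_nat[OF finite_fibres_prod_supported_on[OF assms(1) insert.hyps(1)]]
    by simp
  finally show ?case using insert.IH by simp
qed

section \<open>Flows on the multigraph of a monomial\<close>

text \<open>
  The arc \<open>v\<close> occurs in the multigraph of \<open>m\<close> as often as \<open>x_v\<close> divides \<open>m\<close>; the copies are numbered.
  Multiplying \<open>m\<close> by \<open>x_v\<close> then adds exactly the label \<open>(v, lookup m v)\<close>, so flows before and after a
  replacement can be compared without choosing any bijection between arcs.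
\<close>

definition labels :: "xmonom \<Rightarrow> ((nat \<times> nat) \<times> nat) set" where
  "labels m = {(v, r). r < Poly_Mapping.lookup m v}"

definition flows :: "xmonom \<Rightarrow> ((nat \<times> nat) \<times> nat \<Rightarrow> nat) set" where
  "flows m = supported_on (labels m)"

definition edge_net :: "nat \<times> nat \<Rightarrow> nat \<Rightarrow> int" where
  "edge_net e v = of_bool (fst e = v) - of_bool (snd e = v)"

text \<open>
  The sum runs over the support of \<open>f\<close>, not over the arcs of a graph, so that \<open>net f\<close> is unchanged when
  arcs are added to the graph on which \<open>f\<close> lives.
\<close>

definition net :: "((nat \<times> nat) \<times> nat \<Rightarrow> nat) \<Rightarrow> nat \<Rightarrow> int" where
  "net f v = (\<Sum>e | f e \<noteq> 0. int (f e) * edge_net (fst e) v)"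

text \<open>On integers, \<open>nat\<close> is the positive part.\<close>

definition excess :: "nat \<Rightarrow> (nat \<Rightarrow> int) \<Rightarrow> nat" where
  "excess n a = (\<Sum>v=1..n. nat (a v))"

definition arcs :: "nat \<Rightarrow> (nat \<times> nat) set" where
  "arcs n = {(i, j). 1 \<le> i \<and> i < j \<and> j \<le> n}"

lemma finite_labels [simp]: "finite (labels m)"
proof -
  have "labels m = (SIGMA v:Poly_Mapping.keys m. {..<Poly_Mapping.lookup m v})"
    by (auto simp: labels_def in_keys_iff)
  then show ?thesis by simp
qed

lemma label_notin_labels [simp]: "(v, Poly_Mapping.lookup m v) \<notin> labels m"
  by (simp add: labels_def)

lemma labels_add_single:
  "labels (m + Poly_Mapping.single v 1) = insert (v, Poly_Mapping.lookup m v) (labels m)"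
  by (auto simp: labels_def lookup_add lookup_single when_def split: if_splits)

lemma net_eq_sum:
  assumes "f \<in> supported_on I" and "finite I"
  shows "net f v = (\<Sum>e\<in>I. int (f e) * edge_net (fst e) v)"
  unfolding net_def using assms
  by (intro sum.mono_neutral_left) (force simp: supported_on_def)+

lemma net_fun_upd:
  assumes "f \<in> supported_on I" and "finite I" and "l \<notin> I"
  shows "net (f(l := k)) v = net f v + int k * edge_net (fst l) v"
proof -
  have "f(l := k) \<in> supported_on (insert l I)" using assms(1) by (auto simp: supported_on_def)
  then have "net (f(l := k)) v
    = (\<Sum>e\<in>insert l I. int ((f(l := k)) e) * edge_net (fst e) v)"
    using assms by (intro net_eq_sum) auto
  also have "\<dots> = int k * edge_net (fst l) v + (\<Sum>e\<in>I. int ((f(l := k)) e) * edge_net (fst e) v)"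
    using assms by simp
  also have "(\<Sum>e\<in>I. int ((f(l := k)) e) * edge_net (fst e) v)
    = (\<Sum>e\<in>I. int (f e) * edge_net (fst e) v)"
    using assms by (intro sum.cong) auto
  finally show ?thesis by (simp only: net_eq_sum[OF assms(1,2)] add.commute)
qed

text \<open>
  Acyclicity makes the count finite. Since all arcs \<open>i \<rightarrow> j\<close> have \<open>i < j\<close>, the sum of \<open>(n - v) net f v\<close> over
  the vertices is the sum of \<open>(j - i) f\<close> over the arcs, hence at least every single value of \<open>f\<close>; and
  it is at most \<open>n\<close> times the excess.
\<close>

lemma finite_fibres_flows:
  assumes "Poly_Mapping.keys m \<subseteq> arcs n"
  shows "finite_fibres (flows m) (\<lambda>f. excess n (net f))"
  unfolding finite_fibres_def
proof
  fix d
  have arc: "1 \<le> fst (fst e)" "fst (fst e) < snd (fst e)" "snd (fst e) \<le> n" if "e \<in> labels m" for e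
  proof -
    have "fst e \<in> Poly_Mapping.keys m" using that by (auto simp: labels_def in_keys_iff)
    then have "fst e \<in> arcs n" using assms by blast
    then show "1 \<le> fst (fst e)" "fst (fst e) < snd (fst e)" "snd (fst e) \<le> n"
      by (auto simp: arcs_def)
  qed
  have bound: "f e \<le> n * excess n (net f)" if f: "f \<in> flows m" and e: "e \<in> labels m" for f e
  proof -
    have len: "(\<Sum>v=1..n. (int n - int v) * edge_net (fst e) v) = int (snd (fst e)) - int (fst (fst e))"
      if "e \<in> labels m" for e
    proof -
      have "(\<Sum>v=1..n. (int n - int v) * edge_net (fst e) v)
        = (\<Sum>v=1..n. if v = fst (fst e) then int n - int v else 0)
          - (\<Sum>v=1..n. if v = snd (fst e) then int n - int v else 0)"
        unfolding sum_subtractf[symmetric] by (intro sum.cong) (auto simp: edge_net_def)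
      then show ?thesis using arc[OF that] by (simp add: sum.delta)
    qed
    have "int (f e) \<le> (\<Sum>e\<in>labels m. int (f e))"
      using e by (intro member_le_sum) auto
    also have "\<dots> \<le> (\<Sum>e\<in>labels m. int (f e) * (int (snd (fst e)) - int (fst (fst e))))"
    proof (rule sum_mono)
      fix e assume "e \<in> labels m"
      then have "1 \<le> int (snd (fst e)) - int (fst (fst e))" using arc(2) by fastforce
      then show "int (f e) \<le> int (f e) * (int (snd (fst e)) - int (fst (fst e)))"
        by (simp add: mult_le_cancel_left1)
    qed
    also have "\<dots> = (\<Sum>e\<in>labels m. \<Sum>v=1..n. (int n - int v) * (int (f e) * edge_net (fst e) v))"
      by (intro sum.cong refl) (simp add: len[symmetric] sum_distrib_left mult_ac)
    also have "\<dots> = (\<Sum>v=1..n. (int n - int v) * net f v)"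
      using f by (subst sum.swap)
        (simp add: sum_distrib_left[symmetric] net_eq_sum[of f "labels m"] flows_def)
    also have "\<dots> \<le> (\<Sum>v=1..n. int n * int (nat (net f v)))"
    proof (rule sum_mono)
      fix v assume "v \<in> {1..n}"
      then have "(int n - int v) * net f v \<le> (int n - int v) * int (nat (net f v))"
        by (intro mult_left_mono) auto
      also have "\<dots> \<le> int n * int (nat (net f v))" by (intro mult_right_mono) auto
      finally show "(int n - int v) * net f v \<le> int n * int (nat (net f v))" .
    qed
    also have "\<dots> = int (n * excess n (net f))"
      by (simp add: excess_def sum_distrib_left)
    finally show ?thesis by linarith
  qed
  have "{f \<in> flows m. excess n (net f) = d}
    \<subseteq> {f. \<forall>e. (e \<in> labels m \<longrightarrow> f e \<in> {..n * d}) \<and> (e \<notin> labels m \<longrightarrow> f e = 0)}"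
    using bound by (auto simp: flows_def supported_on_def)
  then show "finite {f \<in> flows m. excess n (net f) = d}"
    by (rule finite_subset) (intro finite_set_of_finite_funs, auto)
qed

section \<open>The invariant and the reduction relation\<close>

definition flow_series :: "nat \<Rightarrow> xmonom \<Rightarrow> int fps" where
  "flow_series n m = weight_series (flows m) (\<lambda>f. excess n (net f))"

lemma flow_series_add_edge:
  "flow_series n (m + Poly_Mapping.single u 1) =
    weight_series (flows m \<times> UNIV) (\<lambda>(g, p). excess n (\<lambda>x. net g x + int p * edge_net u x))"
proof -
  let ?l = "(u, Poly_Mapping.lookup m u)"
  have "bij_betw (\<lambda>(g, p). g(?l := p)) (flows m \<times> UNIV) (flows (m + Poly_Mapping.single u 1))"
    unfolding flows_def labels_add_single
    by (intro bij_betw_byWitness[where f' = "\<lambda>f. (f(?l := 0), f ?l)"])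
      (auto simp: supported_on_def fun_eq_iff)
  moreover have "net (g(?l := p)) = (\<lambda>x. net g x + int p * edge_net u x)" if "g \<in> flows m" for g p
    using that by (simp add: fun_eq_iff flows_def net_fun_upd[of _ "labels m"])
  ultimately show ?thesis
    unfolding flow_series_def by (intro weight_series_bij[symmetric]) auto
qed

lemma flows_add_two_edges:
  assumes "u \<noteq> v"
  obtains h where
    "bij_betw h (flows m \<times> UNIV \<times> UNIV)
      (flows (m + Poly_Mapping.single u 1 + Poly_Mapping.single v 1))"
    "\<And>g p q. g \<in> flows m \<Longrightarrow>
      net (h (g, p, q)) = (\<lambda>x. net g x + int p * edge_net u x + int q * edge_net v x)"
proof -
  let ?k = "(u, Poly_Mapping.lookup m u)" and ?l = "(v, Poly_Mapping.lookup m v)"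
  have lab: "labels (m + Poly_Mapping.single u 1 + Poly_Mapping.single v 1)
    = insert ?l (insert ?k (labels m))"
    using assms by (simp only: labels_add_single lookup_add lookup_single) simp
  have "bij_betw (\<lambda>(g, p, q). g(?k := p, ?l := q)) (flows m \<times> UNIV \<times> UNIV)
    (flows (m + Poly_Mapping.single u 1 + Poly_Mapping.single v 1))"
    using assms unfolding flows_def lab
    by (intro bij_betw_byWitness[where f' = "\<lambda>f. (f(?k := 0, ?l := 0), f ?k, f ?l)"])
      (auto simp: supported_on_def fun_eq_iff)
  moreover have "net (g(?k := p, ?l := q)) x
    = net g x + int p * edge_net u x + int q * edge_net v x" if "g \<in> flows m" for g p q x
  proof -
    have "g(?k := p) \<in> supported_on (insert ?k (labels m))"
      using that by (auto simp: flows_def supported_on_def)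
    then have "net (g(?k := p, ?l := q)) x = net (g(?k := p)) x + int q * edge_net v x"
      using assms by (subst net_fun_upd) auto
    then show ?thesis
      using that by (simp add: flows_def net_fun_upd[of _ "labels m"])
  qed
  ultimately show thesis
    by (intro that[of "\<lambda>(g, p, q). g(?k := p, ?l := q)"]) auto
qed

text \<open>
  The flows are written as triples \<open>(g, p, q)\<close>, where \<open>g\<close> is the flow on the common part \<open>m'\<close> and
  \<open>p\<close>, \<open>q\<close> are the values on the two further arcs. In each case \<open>min p q\<close> units are rerouted along
  \<open>i \<rightarrow> k\<close>, which is neutral because the net vector of \<open>ik\<close> is the sum of those of \<open>ij\<close> and \<open>jk\<close>.
\<close>

lemma flow_series_reduction:
  fixes m' :: xmonom
  defines "s \<equiv> \<lambda>u v. Poly_Mapping.single (u, v) (1::nat)"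
  assumes ijk: "i < j" "j < k" and keys: "Poly_Mapping.keys (m' + s i j + s j k) \<subseteq> arcs n"
  shows "flow_series n (m' + s i j + s j k) + flow_series n (m' + s i k)
    = flow_series n (m' + s i k + s i j) + flow_series n (m' + s j k + s i k)"
proof -
  define X where "X = flows m' \<times> (UNIV :: nat set) \<times> (UNIV :: nat set)"
  define w where "w u v = (\<lambda>(g, p, q). excess n (\<lambda>x. net g x + int p * edge_net u x + int q * edge_net v x))"
    for u v :: "nat \<times> nat"
  have path: "edge_net (i, k) x = edge_net (i, j) x + edge_net (j, k) x" for x
    by (simp add: edge_net_def)
  let ?w = "w (i, j) (j, k)"
  have series: "flow_series n (m' + s u v + s u' v') = weight_series X (w (u, v) (u', v'))"
    if ne: "(u, v) \<noteq> (u', v')" for u v u' v'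
  proof -
    obtain h where "bij_betw h X (flows (m' + s u v + s u' v'))"
      and "\<And>g p q. g \<in> flows m' \<Longrightarrow> net (h (g, p, q)) =
        (\<lambda>x. net g x + int p * edge_net (u, v) x + int q * edge_net (u', v') x)"
      using flows_add_two_edges[OF ne, of m'] unfolding X_def s_def by blast
    then show ?thesis
      unfolding flow_series_def
      by (intro weight_series_bij[symmetric]) (auto simp: X_def w_def)
  qed
  obtain h where bij: "bij_betw h X (flows (m' + s i j + s j k))"
    and "\<And>g p q. g \<in> flows m' \<Longrightarrow> net (h (g, p, q)) =
      (\<lambda>x. net g x + int p * edge_net (i, j) x + int q * edge_net (j, k) x)"
    using flows_add_two_edges[of "(i, j)" "(j, k)" m'] ijk unfolding X_def s_def by blast
  then have "finite_fibres X ?w"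
    by (intro finite_fibres_bij[OF bij _ finite_fibres_flows[OF keys]]) (auto simp: X_def w_def)
  then have "weight_series X ?w + weight_series {x \<in> X. snd (snd x) \<le> fst (snd x) \<and> fst (snd x) \<le> snd (snd x)} ?w
    = weight_series {x \<in> X. snd (snd x) \<le> fst (snd x)} ?w + weight_series {x \<in> X. fst (snd x) \<le> snd (snd x)} ?w"
    by (rule weight_series_inclusion_exclusion) auto
  moreover have "weight_series {x \<in> X. snd (snd x) \<le> fst (snd x)} ?w = weight_series X (w (i, k) (i, j))"
  proof (rule weight_series_bij)
    show "bij_betw (\<lambda>(g, p, q). (g, q, p - q)) {x \<in> X. snd (snd x) \<le> fst (snd x)} X"
      by (intro bij_betw_byWitness[where f' = "\<lambda>(g, p, q). (g, p + q, p)"]) (auto simp: X_def)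
  qed (auto simp: w_def path algebra_simps of_nat_diff)
  moreover have "weight_series {x \<in> X. fst (snd x) \<le> snd (snd x)} ?w = weight_series X (w (j, k) (i, k))"
  proof (rule weight_series_bij)
    show "bij_betw (\<lambda>(g, p, q). (g, q - p, p)) {x \<in> X. fst (snd x) \<le> snd (snd x)} X"
      by (intro bij_betw_byWitness[where f' = "\<lambda>(g, p, q). (g, q, p + q)"]) (auto simp: X_def)
  qed (auto simp: w_def path algebra_simps of_nat_diff)
  moreover have "weight_series {x \<in> X. snd (snd x) \<le> fst (snd x) \<and> fst (snd x) \<le> snd (snd x)} ?w
    = flow_series n (m' + s i k)"
    unfolding s_def flow_series_add_edge
  proof (rule weight_series_bij)
    show "bij_betw (\<lambda>(g, p, q). (g, p)) {x \<in> X. snd (snd x) \<le> fst (snd x) \<and> fst (snd x) \<le> snd (snd x)}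
      (flows m' \<times> UNIV)"
      by (intro bij_betw_byWitness[where f' = "\<lambda>(g, p). (g, p, p)"]) (auto simp: X_def)
  qed (auto simp: w_def path algebra_simps)
  ultimately show ?thesis using ijk by (simp add: series)
qed

text \<open>The invariant \<open>\<Phi>\<close> of the introduction, with \<open>fps_X\<close> in the role of \<open>t = \<beta> + 1\<close>.\<close>

definition weighted_flow_series :: "nat \<Rightarrow> xmonom \<Rightarrow> int fps" where
  "weighted_flow_series n m = flow_series n m * (1 - fps_X) ^ card (labels m)"

lemma card_labels_add_single [simp]:
  "card (labels (m + Poly_Mapping.single v 1)) = Suc (card (labels m))"
  by (simp add: labels_add_single del: One_nat_def)

lemma weighted_flow_series_reduction:
  fixes m' :: xmonom
  defines "s \<equiv> \<lambda>u v. Poly_Mapping.single (u, v) (1::nat)"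
  assumes "i < j" "j < k" "Poly_Mapping.keys (m' + s i j + s j k) \<subseteq> arcs n"
  shows "weighted_flow_series n (m' + s i j + s j k)
    = weighted_flow_series n (m' + s i k + s i j) + weighted_flow_series n (m' + s j k + s i k)
      + (fps_X - 1) * weighted_flow_series n (m' + s i k)"
proof -
  have "flow_series n (m' + s i j + s j k)
    = flow_series n (m' + s i k + s i j) + flow_series n (m' + s j k + s i k)
      - flow_series n (m' + s i k)"
    using flow_series_reduction[of i j k m' n] assms by (simp add: algebra_simps)
  moreover have "(A + B - C) * y ^ Suc (Suc c)
    = A * y ^ Suc (Suc c) + B * y ^ Suc (Suc c) + - y * (C * y ^ Suc c)"
    for A B C y :: "int fps" and c by (simp add: algebra_simps)
  moreover have "fps_X - 1 = - (1 - fps_X :: int fps)" by simp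
  ultimately show ?thesis
    unfolding weighted_flow_series_def s_def card_labels_add_single by (simp only:)
qed

definition has_path_factor :: "xmonom \<Rightarrow> bool" where
  "has_path_factor m \<longleftrightarrow> (\<exists>i j k m'. i < j \<and> j < k \<and>
     m = m' + Poly_Mapping.single (i, j) 1 + Poly_Mapping.single (j, k) 1)"

lemma has_path_factorI:
  assumes "(i, j) \<in> Poly_Mapping.keys m" "(j, k) \<in> Poly_Mapping.keys m" "i < j" "j < k"
  shows "has_path_factor m"
proof -
  have "m = (m - Poly_Mapping.single (i, j) 1 - Poly_Mapping.single (j, k) 1)
    + Poly_Mapping.single (i, j) 1 + Poly_Mapping.single (j, k) 1"
    using assms
    by (intro poly_mapping_eqI) (auto simp: lookup_add lookup_minus lookup_single when_def in_keys_iff)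
  then show ?thesis using assms(3,4) unfolding has_path_factor_def by blast
qed

text \<open>
  If no arc ends where another one starts, then \<open>net f v\<close> is the total on the arcs starting at \<open>v\<close> if
  there are any, and is at most 0 otherwise. In both cases its positive part is the total on
  the arcs starting at \<open>v\<close>, and every arc starts at exactly one vertex.
\<close>

lemma excess_eq_total:
  assumes "Poly_Mapping.keys m \<subseteq> arcs n" and "\<not> has_path_factor m" and f: "f \<in> flows m"
  shows "excess n (net f) = (\<Sum>e\<in>labels m. f e)"
proof -
  have key: "fst e \<in> Poly_Mapping.keys m" if "e \<in> labels m" for e
    using that by (auto simp: labels_def in_keys_iff)
  then have arc: "fst e \<in> arcs n" if "e \<in> labels m" for e
    using that assms(1) by blast
  have no_path: "snd (fst d) \<noteq> fst (fst e)" if "d \<in> labels m" "e \<in> labels m" for d e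
    using has_path_factorI[of "fst (fst d)" "snd (fst d)" m "snd (fst e)"]
      key[OF that(1)] key[OF that(2)] arc[OF that(1)] arc[OF that(2)] assms(2)
    by (auto simp: arcs_def split_beta)
  have net: "net f v = (\<Sum>e\<in>labels m. int (f e) * edge_net (fst e) v)" for v
    using f by (intro net_eq_sum) (auto simp: flows_def)
  have "int (nat (net f v)) = (\<Sum>e\<in>labels m. int (f e) * of_bool (fst (fst e) = v))" for v
  proof (cases "\<exists>e\<in>labels m. fst (fst e) = v")
    case True
    then have "net f v = (\<Sum>e\<in>labels m. int (f e) * of_bool (fst (fst e) = v))"
      unfolding net using no_path by (intro sum.cong) (auto simp: edge_net_def)
    moreover have "0 \<le> (\<Sum>e\<in>labels m. int (f e) * of_bool (fst (fst e) = v))"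
      by (intro sum_nonneg) auto
    ultimately show ?thesis by simp
  next
    case False
    then have "net f v \<le> 0"
      unfolding net by (intro sum_nonpos) (auto simp: edge_net_def)
    moreover have "(\<Sum>e\<in>labels m. int (f e) * of_bool (fst (fst e) = v)) = 0"
      using False by (intro sum.neutral) auto
    ultimately show ?thesis by simp
  qed
  then have "int (excess n (net f))
    = (\<Sum>v=1..n. \<Sum>e\<in>labels m. int (f e) * of_bool (fst (fst e) = v))"
    by (simp add: excess_def)
  also have "\<dots> = (\<Sum>e\<in>labels m. \<Sum>v=1..n. if fst (fst e) = v then int (f e) else 0)"
    by (subst sum.swap) (intro sum.cong, auto)
  also have "\<dots> = (\<Sum>e\<in>labels m. int (f e))"
  proof (intro sum.cong refl)
    fix e assume "e \<in> labels m"
    from arc[OF this] show "(\<Sum>v=1..n. if fst (fst e) = v then int (f e) else 0) = int (f e)"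
      by (auto simp: arcs_def)
  qed
  also have "\<dots> = int (\<Sum>e\<in>labels m. f e)" by simp
  finally show ?thesis by linarith
qed

text \<open>
  By the previous lemma the values of the flow are free numbers counted by their sum; the
  one-point set below is the trivial first factor on which they are attached.
\<close>

lemma weighted_flow_series_reduced:
  assumes "Poly_Mapping.keys m \<subseteq> arcs n" and "\<not> has_path_factor m"
  shows "weighted_flow_series n m = 1"
proof -
  have "bij_betw (Pair ()) (flows m) ({()} \<times> supported_on (labels m))"
    by (auto simp: bij_betw_def inj_on_def flows_def)
  then have "flow_series n m
    = weight_series ({()} \<times> supported_on (labels m)) (\<lambda>(x, r). 0 + (\<Sum>e\<in>labels m. r e))"
    unfolding flow_series_def
    by (rule weight_series_bij) (use excess_eq_total[OF assms] in auto)
  moreover have "weight_series {()} (\<lambda>_. 0) = 1"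
    by (rule fps_ext) (simp add: weight_series_def)
  ultimately show ?thesis
    using weight_series_prod_supported_on[of "{()}" "\<lambda>_. 0" "labels m"]
    by (simp add: weighted_flow_series_def finite_fibres_def)
qed

section \<open>From monomials to polynomials\<close>

text \<open>
  Substitutes \<open>\<beta> = t - 1\<close>; the variable of the power series is \<open>t\<close>.
\<close>

definition shift_beta :: "int poly \<Rightarrow> int fps" where
  "shift_beta c = fps_of_poly (pcompose c [:-1, 1:])"

text \<open>The extension of \<open>\<Phi>\<close> to polynomials, linear over the coefficients in \<open>\<beta>\<close>.\<close>

definition polynomial_series :: "nat \<Rightarrow> xpoly \<Rightarrow> int fps" where
  "polynomial_series n p = (\<Sum>m \<in> Poly_Mapping.keys p.
     shift_beta (Poly_Mapping.lookup p m) * weighted_flow_series n m)"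

definition monomials_within :: "nat \<Rightarrow> xpoly \<Rightarrow> bool" where
  "monomials_within n p \<longleftrightarrow> (\<forall>m \<in> Poly_Mapping.keys p. Poly_Mapping.keys m \<subseteq> arcs n)"

lemma shift_beta_simps [simp]:
  "shift_beta 0 = 0" "shift_beta 1 = 1" "shift_beta (c + d) = shift_beta c + shift_beta d"
  "shift_beta (c * d) = shift_beta c * shift_beta d" "shift_beta [:0, 1:] = fps_X - 1"
proof -
  have "fps_of_poly [:-1, 1::int:] = fps_X - 1"
    by (rule fps_ext) (auto simp: coeff_pCons split: nat.splits)
  then show "shift_beta [:0, 1:] = fps_X - 1"
    by (simp add: shift_beta_def pcompose_pCons)
qed (simp_all add: shift_beta_def pcompose_1 pcompose_add pcompose_mult fps_of_poly_add fps_of_poly_mult)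

lemma shift_beta_sum: "shift_beta (\<Sum>x\<in>A. g x) = (\<Sum>x\<in>A. shift_beta (g x))"
  by (induction A rule: infinite_finite_induct) auto

lemma polynomial_series_eq_sum:
  assumes "finite U" and "Poly_Mapping.keys p \<subseteq> U"
  shows "polynomial_series n p
    = (\<Sum>m\<in>U. shift_beta (Poly_Mapping.lookup p m) * weighted_flow_series n m)"
  unfolding polynomial_series_def using assms
  by (intro sum.mono_neutral_left) (auto simp: in_keys_iff)

lemma polynomial_series_add:
  "polynomial_series n (p + q) = polynomial_series n p + polynomial_series n q"
proof -
  let ?U = "Poly_Mapping.keys p \<union> Poly_Mapping.keys q"
  have "Poly_Mapping.keys (p + q) \<subseteq> ?U" by (rule Poly_Mapping.keys_add)
  then show ?thesis
    by (simp add: polynomial_series_eq_sum[of ?U] lookup_add algebra_simps sum.distrib)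
qed

lemma polynomial_series_single:
  "polynomial_series n (Poly_Mapping.single m c) = shift_beta c * weighted_flow_series n m"
  by (subst polynomial_series_eq_sum[of "{m}"]) auto

lemma replacement_expand:
  "Poly_Mapping.single m' c * (xvar i k * xvar i j + xvar j k * xvar i k + beta * xvar i k)
   = Poly_Mapping.single (m' + Poly_Mapping.single (i, k) 1 + Poly_Mapping.single (i, j) 1) c
     + Poly_Mapping.single (m' + Poly_Mapping.single (j, k) 1 + Poly_Mapping.single (i, k) 1) c
     + Poly_Mapping.single (m' + Poly_Mapping.single (i, k) 1) (c * [:0, 1:])"
  by (simp add: xvar_def beta_def xconst_def distrib_left mult_single add.assoc)

lemma reduction_stepE:
  assumes "reduction_step p q" and "monomials_within n p"
  obtains i j k m m' c where "1 \<le> i" "i < j" "j < k" "k \<le> n" "m \<in> Poly_Mapping.keys p"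
    "c = Poly_Mapping.lookup p m"
    "m = m' + Poly_Mapping.single (i, j) 1 + Poly_Mapping.single (j, k) 1"
    "q = p - Poly_Mapping.single m c
       + (Poly_Mapping.single (m' + Poly_Mapping.single (i, k) 1 + Poly_Mapping.single (i, j) 1) c
       + Poly_Mapping.single (m' + Poly_Mapping.single (j, k) 1 + Poly_Mapping.single (i, k) 1) c
       + Poly_Mapping.single (m' + Poly_Mapping.single (i, k) 1) (c * [:0, 1:]))"
  using assms(1)
proof cases
  case (1 i j k m c m')
  have "(i, j) \<in> Poly_Mapping.keys m" "(j, k) \<in> Poly_Mapping.keys m"
    using 1 by (auto simp: in_keys_iff lookup_add)
  moreover have "Poly_Mapping.keys m \<subseteq> arcs n"
    using 1 assms(2) by (auto simp: monomials_within_def)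
  ultimately have "(i, j) \<in> arcs n" "(j, k) \<in> arcs n" by auto
  then have "1 \<le> i" "k \<le> n" by (auto simp: arcs_def)
  with 1 show thesis
    by (intro that[of i j k m c m']) (simp_all only: replacement_expand)
qed

lemma keys_reduction_step:
  fixes p :: xpoly
  shows "Poly_Mapping.keys (p - Poly_Mapping.single m (Poly_Mapping.lookup p m)
      + (Poly_Mapping.single m1 c1 + Poly_Mapping.single m2 c2 + Poly_Mapping.single m3 c3))
    \<subseteq> (Poly_Mapping.keys p - {m}) \<union> {m1, m2, m3}"
  by (auto simp: in_keys_iff lookup_add lookup_minus lookup_single when_def split: if_splits)

lemma reduction_step_invariant:
  assumes "reduction_step p q" and "monomials_within n p"
  shows "monomials_within n q" and "polynomial_series n q = polynomial_series n p"
proof -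
  obtain i j k m m' c where ijk: "1 \<le> i" "i < j" "j < k" "k \<le> n"
    and m: "m \<in> Poly_Mapping.keys p" and c: "c = Poly_Mapping.lookup p m"
    and m_eq: "m = m' + Poly_Mapping.single (i, j) 1 + Poly_Mapping.single (j, k) 1"
    and q: "q = p - Poly_Mapping.single m c
       + (Poly_Mapping.single (m' + Poly_Mapping.single (i, k) 1 + Poly_Mapping.single (i, j) 1) c
       + Poly_Mapping.single (m' + Poly_Mapping.single (j, k) 1 + Poly_Mapping.single (i, k) 1) c
       + Poly_Mapping.single (m' + Poly_Mapping.single (i, k) 1) (c * [:0, 1:]))"
    using reduction_stepE[OF assms] by metis
  have keys_m: "Poly_Mapping.keys m \<subseteq> arcs n"
    using m assms(2) by (simp add: monomials_within_def)
  have keys_m': "Poly_Mapping.keys m' \<subseteq> arcs n"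
  proof
    fix v assume "v \<in> Poly_Mapping.keys m'"
    then have "v \<in> Poly_Mapping.keys m" by (simp add: m_eq in_keys_iff lookup_add)
    with keys_m show "v \<in> arcs n" by blast
  qed
  have arcs: "(i, j) \<in> arcs n" "(j, k) \<in> arcs n" "(i, k) \<in> arcs n"
    using ijk by (auto simp: arcs_def)
  have add: "Poly_Mapping.keys (a + Poly_Mapping.single v 1) \<subseteq> arcs n"
    if "Poly_Mapping.keys a \<subseteq> arcs n" "v \<in> arcs n" for a :: xmonom and v
    using that Poly_Mapping.keys_add[of a "Poly_Mapping.single v 1"] by auto
  show "monomials_within n q"
    unfolding monomials_within_def
  proof
    fix a assume "a \<in> Poly_Mapping.keys q"
    then have "a \<in> Poly_Mapping.keys p \<or>
      a \<in> {m' + Poly_Mapping.single (i, k) 1 + Poly_Mapping.single (i, j) 1,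
           m' + Poly_Mapping.single (j, k) 1 + Poly_Mapping.single (i, k) 1,
           m' + Poly_Mapping.single (i, k) 1}"
      unfolding q c using keys_reduction_step by blast
    then show "Poly_Mapping.keys a \<subseteq> arcs n"
      using assms(2) add keys_m' arcs unfolding monomials_within_def by blast
  qed
  have "polynomial_series n (p - Poly_Mapping.single m c) + polynomial_series n (Poly_Mapping.single m c)
    = polynomial_series n p"
    by (simp flip: polynomial_series_add)
  then have "polynomial_series n (p - Poly_Mapping.single m c)
    = polynomial_series n p - shift_beta c * weighted_flow_series n m"
    by (simp add: polynomial_series_single algebra_simps)
  moreover have "weighted_flow_series n m
    = weighted_flow_series n (m' + Poly_Mapping.single (i, k) 1 + Poly_Mapping.single (i, j) 1)
      + weighted_flow_series n (m' + Poly_Mapping.single (j, k) 1 + Poly_Mapping.single (i, k) 1)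
      + (fps_X - 1) * weighted_flow_series n (m' + Poly_Mapping.single (i, k) 1)"
    using weighted_flow_series_reduction[of i j k m' n] ijk keys_m unfolding m_eq by blast
  ultimately show "polynomial_series n q = polynomial_series n p"
    unfolding q polynomial_series_add polynomial_series_single
    by (simp only: shift_beta_simps distrib_left mult.assoc) simp
qed

lemma reductions_invariant:
  assumes "reduction_step\<^sup>*\<^sup>* p q" and "monomials_within n p"
  shows "monomials_within n q \<and> polynomial_series n q = polynomial_series n p"
  using assms by (induction rule: rtranclp_induct) (auto simp: reduction_step_invariant)

lemma is_reduced_iff: "is_reduced p \<longleftrightarrow> (\<forall>m \<in> Poly_Mapping.keys p. \<not> has_path_factor m)"
  by (auto simp: is_reduced_def has_path_factor_def)

lemma polynomial_series_reduced:
  assumes "monomials_within n q" and "is_reduced q"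
  shows "polynomial_series n q = shift_beta (eval_xpoly (\<lambda>_. 1) q)"
proof -
  have "polynomial_series n q = (\<Sum>m \<in> Poly_Mapping.keys q. shift_beta (Poly_Mapping.lookup q m))"
    unfolding polynomial_series_def using assms
    by (intro sum.cong) (auto simp: monomials_within_def is_reduced_iff weighted_flow_series_reduced)
  then show ?thesis by (simp add: eval_xpoly_def shift_beta_sum)
qed

section \<open>Termination\<close>

text \<open>
  An arc \<open>i \<rightarrow> j\<close> counts the more the shorter it is. Two of the three new monomials of a step
  replace one arc of the path \<open>i \<rightarrow> j \<rightarrow> k\<close> by the longer arc \<open>i \<rightarrow> k\<close>, the third one replaces
  both, so the rank drops in each of them.
\<close>

definition rank :: "nat \<Rightarrow> xmonom \<Rightarrow> nat" where
  "rank n m = (\<Sum>e\<in>labels m. n + fst (fst e) - snd (fst e))"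

lemma rank_add_single:
  "rank n (m + Poly_Mapping.single v 1) = rank n m + (n + fst v - snd v)"
  unfolding rank_def labels_add_single by simp

text \<open>
  A step trades one monomial for at most three of smaller rank; with base 4 the three together weigh at
  most three quarters of the one removed.
\<close>

definition potential :: "nat \<Rightarrow> xpoly \<Rightarrow> nat" where
  "potential n p = (\<Sum>m \<in> Poly_Mapping.keys p. 4 ^ rank n m)"

lemma potential_decreases:
  assumes "reduction_step p q" and "monomials_within n p"
  shows "potential n q < potential n p"
proof -
  obtain i j k m m' c where ijk: "1 \<le> i" "i < j" "j < k" "k \<le> n"
    and m: "m \<in> Poly_Mapping.keys p" and c: "c = Poly_Mapping.lookup p m"
    and m_eq: "m = m' + Poly_Mapping.single (i, j) 1 + Poly_Mapping.single (j, k) 1"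
    and q: "q = p - Poly_Mapping.single m c
       + (Poly_Mapping.single (m' + Poly_Mapping.single (i, k) 1 + Poly_Mapping.single (i, j) 1) c
       + Poly_Mapping.single (m' + Poly_Mapping.single (j, k) 1 + Poly_Mapping.single (i, k) 1) c
       + Poly_Mapping.single (m' + Poly_Mapping.single (i, k) 1) (c * [:0, 1:]))"
    using reduction_stepE[OF assms] by metis
  define m1 m2 m3 where "m1 = m' + Poly_Mapping.single (i, k) 1 + Poly_Mapping.single (i, j) 1"
    and "m2 = m' + Poly_Mapping.single (j, k) 1 + Poly_Mapping.single (i, k) 1"
    and "m3 = m' + Poly_Mapping.single (i, k) 1"
  note new = m1_def m2_def m3_def
  have "rank n m1 < rank n m" "rank n m2 < rank n m" "rank n m3 < rank n m"
    using ijk unfolding new m_eq rank_add_single by auto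
  then have small: "4 * 4 ^ rank n m1 \<le> (4::nat) ^ rank n m" "4 * 4 ^ rank n m2 \<le> (4::nat) ^ rank n m"
    "4 * 4 ^ rank n m3 \<le> (4::nat) ^ rank n m"
    by (metis Suc_leI power_Suc power_increasing one_le_numeral)+
  have "Poly_Mapping.keys q \<subseteq> (Poly_Mapping.keys p - {m}) \<union> {m1, m2, m3}"
    unfolding q c new using keys_reduction_step by blast
  then have "potential n q \<le> (\<Sum>a \<in> (Poly_Mapping.keys p - {m}) \<union> {m1, m2, m3}. 4 ^ rank n a)"
    unfolding potential_def by (intro sum_mono2) auto
  also have "\<dots> \<le> (\<Sum>a \<in> Poly_Mapping.keys p - {m}. 4 ^ rank n a) + (\<Sum>a \<in> {m1, m2, m3}. 4 ^ rank n a)"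
    by (subst sum_Un_nat) (simp_all only: finite_Diff finite_keys finite.intros diff_le_self)
  also have "(\<Sum>a \<in> {m1, m2, m3}. 4 ^ rank n a) \<le> (4::nat) ^ rank n m1 + 4 ^ rank n m2 + 4 ^ rank n m3"
    by (simp add: sum.insert_if)
  also have "\<dots> < 4 ^ rank n m"
  proof -
    have "0 < (4::nat) ^ rank n m" by simp
    with small show ?thesis by linarith
  qed
  finally have "potential n q < (\<Sum>a \<in> Poly_Mapping.keys p - {m}. 4 ^ rank n a) + 4 ^ rank n m"
    by simp
  also have "\<dots> = potential n p"
    unfolding potential_def using m by (subst sum.remove[of _ m]) auto
  finally show ?thesis .
qed

lemma exists_reduced_polynomial:
  assumes "monomials_within n p"
  shows "\<exists>q. reduced_polynomial_of p q"
  using assms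
proof (induction "potential n p" arbitrary: p rule: less_induct)
  case less
  show ?case
  proof (cases "is_reduced p")
    case True
    then show ?thesis by (auto simp: reduced_polynomial_of_def)
  next
    case False
    then obtain i j k m m' where "i < j" "j < k" "m \<in> Poly_Mapping.keys p"
      "m = m' + Poly_Mapping.single (i, j) 1 + Poly_Mapping.single (j, k) 1"
      unfolding is_reduced_def by blast
    from reduction_step.intros[OF this(1,2,3) refl this(4)]
    obtain q where step: "reduction_step p q" by blast
    have "\<exists>r. reduced_polynomial_of q r"
      using less.hyps[OF potential_decreases[OF step less.prems]]
        reduction_step_invariant(1)[OF step less.prems] by blast
    with step show ?thesis
      by (meson reduced_polynomial_of_def converse_rtranclp_into_rtranclp)
  qed
qed

section \<open>The complete graph\<close>

definition complete_monom :: "nat \<Rightarrow> xmonom" where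
  "complete_monom n = (\<Sum>v\<in>arcs n. Poly_Mapping.single v 1)"

lemma finite_arcs [simp]: "finite (arcs n)"
  by (rule finite_subset[of _ "{..n} \<times> {..n}"]) (auto simp: arcs_def)

lemma w0_eq_single: "w0 n = Poly_Mapping.single (complete_monom n) 1"
proof -
  have "(\<Prod>(i, j)\<in>A. xvar i j) = Poly_Mapping.single (\<Sum>v\<in>A. Poly_Mapping.single v 1) 1"
    if "finite A" for A
    using that by (induction rule: finite_induct) (auto simp: xvar_def mult_single)
  from this[OF finite_arcs] show ?thesis
    unfolding w0_def complete_monom_def by (simp add: arcs_def)
qed

lemma labels_complete_monom: "labels (complete_monom n) = arcs n \<times> {0}"
proof -
  have "labels (\<Sum>v\<in>A. Poly_Mapping.single v 1) = A \<times> {0}" if "finite A" for A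
    using that
  proof (induction rule: finite_induct)
    case empty
    then show ?case by (simp add: labels_def)
  next
    case (insert v A)
    have "Poly_Mapping.lookup (\<Sum>v\<in>A. Poly_Mapping.single v (1::nat)) v = 0"
      using insert.hyps by (auto simp: lookup_sum lookup_single when_def)
    moreover have "labels (\<Sum>v\<in>insert v A. Poly_Mapping.single v 1)
      = labels ((\<Sum>v\<in>A. Poly_Mapping.single v 1) + Poly_Mapping.single v 1)"
      using insert.hyps by (simp add: add.commute)
    ultimately show ?case
      unfolding labels_add_single insert.IH by auto
  qed
  then show ?thesis by (simp add: complete_monom_def)
qed

lemma keys_complete_monom: "Poly_Mapping.keys (complete_monom n) = arcs n"
proof -
  have "v \<in> Poly_Mapping.keys (complete_monom n) \<longleftrightarrow> (v, 0) \<in> labels (complete_monom n)" for v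
    by (simp add: labels_def in_keys_iff)
  then show ?thesis by (auto simp: labels_complete_monom)
qed

lemma card_arcs: "card (arcs n) = n choose 2"
proof -
  have "card (arcs n) = card {A. A \<subseteq> {1..n} \<and> card A = 2}"
  proof (rule bij_betw_same_card)
    show "bij_betw (\<lambda>(i, j). {i, j}) (arcs n) {A. A \<subseteq> {1..n} \<and> card A = 2}"
      unfolding bij_betw_def
    proof
      show "inj_on (\<lambda>(i, j). {i, j}) (arcs n)"
        by (auto simp: inj_on_def arcs_def doubleton_eq_iff)
      show "(\<lambda>(i, j). {i, j}) ` arcs n = {A. A \<subseteq> {1..n} \<and> card A = 2}"
      proof (intro equalityI subsetI)
        fix A assume "A \<in> {A. A \<subseteq> {1..n} \<and> card A = 2}"
        then obtain i j where "A = {i, j}" "i < j" "A \<subseteq> {1..n}"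
          by (auto simp: card_2_iff) (metis insert_commute linorder_neqE_nat)
        then show "A \<in> (\<lambda>(i, j). {i, j}) ` arcs n"
          by (intro image_eqI[of _ _ "(i, j)"]) (auto simp: arcs_def)
      qed (auto simp: arcs_def)
    qed
  qed
  then show ?thesis by (simp add: n_subsets)
qed

section \<open>The Chan-Robbins-Yuen polytope as a flow polytope\<close>

text \<open>
  Integer flows of value \<open>d\<close> from the source \<open>0\<close> to the sink \<open>n + 1\<close> on the complete graph with
  vertices \<open>0, \<dots>, n + 1\<close>, conserved at the vertices \<open>1, \<dots>, n\<close>.
\<close>

definition network_flows :: "nat \<Rightarrow> nat \<Rightarrow> (nat \<times> nat \<Rightarrow> nat) set" where
  "network_flows n d = {F.
     (\<forall>u v. \<not> (u < v \<and> v \<le> Suc n) \<longrightarrow> F (u, v) = 0) \<and>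
     (\<forall>v\<in>{1..n}. (\<Sum>u<v. F (u, v)) = (\<Sum>w=Suc v..Suc n. F (v, w))) \<and>
     (\<Sum>w=Suc 0..Suc n. F (0, w)) = d}"

lemma net_complete_flow:
  assumes f: "f \<in> flows (complete_monom n)" and v: "v \<in> {1..n}"
  shows "net f v = (\<Sum>w=Suc v..n. int (f ((v, w), 0))) - (\<Sum>u=1..<v. int (f ((u, v), 0)))"
proof -
  have "net f v = (\<Sum>e\<in>arcs n \<times> {0}. int (f e) * edge_net (fst e) v)"
    using f by (intro net_eq_sum) (auto simp: flows_def labels_complete_monom)
  also have "\<dots> = (\<Sum>e\<in>arcs n. int (f (e, 0)) * edge_net e v)"
    by (intro sum.reindex_bij_witness[of _ "\<lambda>e. (e, 0)" fst]) auto
  also have "\<dots> = (\<Sum>e\<in>arcs n. (if fst e = v then int (f (e, 0)) else 0)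
      - (if snd e = v then int (f (e, 0)) else 0))"
    by (intro sum.cong) (auto simp: edge_net_def)
  also have "\<dots> = (\<Sum>e | e \<in> arcs n \<and> fst e = v. int (f (e, 0)))
      - (\<Sum>e | e \<in> arcs n \<and> snd e = v. int (f (e, 0)))"
    unfolding sum_subtractf by (simp add: sum.If_cases Int_def)
  also have "(\<Sum>e | e \<in> arcs n \<and> fst e = v. int (f (e, 0))) = (\<Sum>w=Suc v..n. int (f ((v, w), 0)))"
    using v by (intro sum.reindex_bij_witness[of _ "Pair v" snd]) (auto simp: arcs_def)
  also have "(\<Sum>e | e \<in> arcs n \<and> snd e = v. int (f (e, 0))) = (\<Sum>u=1..<v. int (f ((u, v), 0)))"
    using v by (intro sum.reindex_bij_witness[of _ "\<lambda>u. (u, v)" fst]) (auto simp: arcs_def)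
  finally show ?thesis .
qed

text \<open>
  Conservation at \<open>v\<close> only constrains the difference between what comes from the source and
  what goes to the sink. This difference must be \<open>net f v\<close>, so the smaller of the two amounts is free.
\<close>

lemma conservation_iff_net:
  assumes f: "f \<in> flows (complete_monom n)" and v: "v \<in> {1..n}"
    and agree: "\<And>e. e \<in> arcs n \<Longrightarrow> F e = f (e, 0)"
  shows "(\<Sum>u<v. F (u, v)) = (\<Sum>w=Suc v..Suc n. F (v, w))
    \<longleftrightarrow> int (F (0, v)) - int (F (v, Suc n)) = net f v"
proof -
  have "{..<v} = insert 0 {1..<v}" using v by auto
  then have "(\<Sum>u<v. F (u, v)) = F (0, v) + (\<Sum>u=1..<v. F (u, v))" by simp
  moreover have "(\<Sum>u=1..<v. F (u, v)) = (\<Sum>u=1..<v. f ((u, v), 0))"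
    using v by (intro sum.cong) (auto simp: agree arcs_def)
  moreover have "(\<Sum>w=Suc v..Suc n. F (v, w)) = (\<Sum>w=Suc v..n. F (v, w)) + F (v, Suc n)"
    using v by simp
  moreover have "(\<Sum>w=Suc v..n. F (v, w)) = (\<Sum>w=Suc v..n. f ((v, w), 0))"
    using v by (intro sum.cong) (auto simp: agree arcs_def)
  ultimately show ?thesis
    unfolding net_complete_flow[OF f v] of_nat_sum[symmetric] by linarith
qed

text \<open>
  The flow on the network that extends \<open>f\<close> by its forced exchange with source and sink and sends
  \<open>r v\<close> further units straight through each inner vertex \<open>v\<close>; the number \<open>r 0\<close> is used for the
  arc from the source to the sink.
\<close>

definition complete_with_ends :: "nat \<Rightarrow> ((nat \<times> nat) \<times> nat \<Rightarrow> nat) \<Rightarrow> (nat \<Rightarrow> nat) \<Rightarrow> nat \<times> nat \<Rightarrow> nat"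
  where "complete_with_ends n f r = (\<lambda>(u, v).
    if (u, v) \<in> arcs n then f ((u, v), 0)
    else if u = 0 \<and> v \<in> {1..n} then nat (net f v) + r v
    else if u \<in> {1..n} \<and> v = Suc n then nat (- net f u) + r u
    else if u = 0 \<and> v = Suc n then r 0
    else 0)"

definition inner_flow :: "nat \<Rightarrow> (nat \<times> nat \<Rightarrow> nat) \<Rightarrow> (nat \<times> nat) \<times> nat \<Rightarrow> nat" where
  "inner_flow n F = (\<lambda>(e, l). if e \<in> arcs n \<and> l = 0 then F e else 0)"

definition through_flow :: "nat \<Rightarrow> (nat \<times> nat \<Rightarrow> nat) \<Rightarrow> nat \<Rightarrow> nat" where
  "through_flow n F v = (if v = 0 then F (0, Suc n) else if v \<le> n then min (F (0, v)) (F (v, Suc n)) else 0)"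

text \<open>
  The inverse of \<open>complete_with_ends\<close> consists of \<open>inner_flow\<close> and \<open>through_flow\<close>: of two numbers with
  difference \<open>a\<close>, the larger exceeds their minimum by the absolute value of \<open>a\<close>.
\<close>

lemma card_network_flows:
  "card {x \<in> flows (complete_monom n) \<times> supported_on {0..n}.
      (case x of (f, r) \<Rightarrow> excess n (net f) + (\<Sum>v\<in>{0..n}. r v)) = d} = card (network_flows n d)"
  (is "card ?X = _")
proof (rule bij_betw_same_card[of "\<lambda>(f, r). complete_with_ends n f r"],
    rule bij_betw_byWitness[where f' = "\<lambda>F. (inner_flow n F, through_flow n F)"])
  have inner_in: "inner_flow n F \<in> flows (complete_monom n)" for F
    by (auto simp: inner_flow_def flows_def supported_on_def labels_complete_monom)
  have through_in: "through_flow n F \<in> supported_on {0..n}" for F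
    by (auto simp: through_flow_def supported_on_def)
  have net_inner: "int (F (0, v)) - int (F (v, Suc n)) = net (inner_flow n F) v"
    if "F \<in> network_flows n d" "v \<in> {1..n}" for F v
    using conservation_iff_net[OF inner_in that(2), of F F] that
    by (auto simp: network_flows_def inner_flow_def)
  have ends: "F (0, v) = nat (net (inner_flow n F) v) + through_flow n F v"
    "F (v, Suc n) = nat (- net (inner_flow n F) v) + through_flow n F v"
    if "F \<in> network_flows n d" "v \<in> {1..n}" for F v
    using net_inner[OF that] that(2) by (auto simp: through_flow_def)
  have split0: "(\<Sum>v\<in>{0..n}. r v) = r 0 + (\<Sum>v=1..n. r v)" for r :: "nat \<Rightarrow> nat"
    by (simp add: sum.atLeast_Suc_atMost)
  show "\<forall>x\<in>?X. (inner_flow n (case x of (f, r) \<Rightarrow> complete_with_ends n f r),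
      through_flow n (case x of (f, r) \<Rightarrow> complete_with_ends n f r)) = x"
  proof
    fix x assume x: "x \<in> ?X"
    obtain f r where fr: "x = (f, r)" by (cases x)
    have "inner_flow n (complete_with_ends n f r) = f"
      using x by (auto simp: fr inner_flow_def complete_with_ends_def fun_eq_iff flows_def
          supported_on_def labels_complete_monom)
    moreover have "through_flow n (complete_with_ends n f r) v = r v" for v
      using x by (auto simp: fr through_flow_def complete_with_ends_def arcs_def supported_on_def)
    ultimately show "(inner_flow n (case x of (f, r) \<Rightarrow> complete_with_ends n f r),
      through_flow n (case x of (f, r) \<Rightarrow> complete_with_ends n f r)) = x"
      by (simp add: fr fun_eq_iff)
  qed
  show "\<forall>F\<in>network_flows n d. (case (inner_flow n F, through_flow n F) of
      (f, r) \<Rightarrow> complete_with_ends n f r) = F"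
  proof
    fix F assume F: "F \<in> network_flows n d"
    have "complete_with_ends n (inner_flow n F) (through_flow n F) (u, v) = F (u, v)" for u v
    proof -
      consider "(u, v) \<in> arcs n" | "u = 0" "v \<in> {1..n}" | "u \<in> {1..n}" "v = Suc n"
        | "u = 0" "v = Suc n" | "\<not> (u < v \<and> v \<le> Suc n)"
        by (force simp: arcs_def)
      then show ?thesis
      proof cases
        case 1
        then show ?thesis by (simp add: complete_with_ends_def inner_flow_def)
      next
        case 2
        then show ?thesis using ends(1)[OF F 2(2)] by (simp add: complete_with_ends_def arcs_def)
      next
        case 3
        then show ?thesis using ends(2)[OF F 3(1)] by (simp add: complete_with_ends_def arcs_def)
      next
        case 4
        then show ?thesis by (simp add: complete_with_ends_def through_flow_def arcs_def)
      next
        case 5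
        then have "F (u, v) = 0" using F by (simp add: network_flows_def)
        then show ?thesis using 5 by (auto simp: complete_with_ends_def arcs_def)
      qed
    qed
    then show "(case (inner_flow n F, through_flow n F) of (f, r) \<Rightarrow> complete_with_ends n f r) = F"
      by (simp add: fun_eq_iff)
  qed
  show "(\<lambda>(f, r). complete_with_ends n f r) ` ?X \<subseteq> network_flows n d"
  proof safe
    fix f r assume f: "f \<in> flows (complete_monom n)" and r: "r \<in> supported_on {0..n}"
    let ?F = "complete_with_ends n f r"
    let ?d = "excess n (net f) + (\<Sum>v\<in>{0..n}. r v)"
    have "(\<Sum>u<v. ?F (u, v)) = (\<Sum>w=Suc v..Suc n. ?F (v, w))" if "v \<in> {1..n}" for v
      using conservation_iff_net[OF f that, of ?F] that
      by (auto simp: complete_with_ends_def arcs_def)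
    moreover have "(\<Sum>w=Suc 0..Suc n. ?F (0, w)) = (\<Sum>v=1..n. nat (net f v) + r v) + r 0"
      by (simp add: complete_with_ends_def arcs_def)
    ultimately show "?F \<in> network_flows n ?d"
      unfolding network_flows_def split0
      by (auto simp: excess_def sum.distrib complete_with_ends_def arcs_def)
  qed
  show "(\<lambda>F. (inner_flow n F, through_flow n F)) ` network_flows n d \<subseteq> ?X"
  proof safe
    fix F assume F: "F \<in> network_flows n d"
    show "inner_flow n F \<in> flows (complete_monom n)" "through_flow n F \<in> supported_on {0..n}"
      by (rule inner_in through_in)+
    have "excess n (net (inner_flow n F)) + (\<Sum>v\<in>{0..n}. through_flow n F v)
      = (\<Sum>v=1..n. F (0, v)) + F (0, Suc n)"
      using ends(1)[OF F] unfolding split0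
      by (simp add: excess_def sum.distrib[symmetric] through_flow_def[of n F 0] add.commute)
    also have "\<dots> = d" using F by (simp add: network_flows_def)
    finally show "excess n (net (inner_flow n F)) + (\<Sum>v\<in>{0..n}. through_flow n F v) = d" .
  qed
qed

lemma network_flow_conservation:
  assumes "F \<in> network_flows n d" and "Suc v \<le> n"
  shows "(\<Sum>u\<le>v. F (u, Suc v)) = (\<Sum>w=Suc (Suc v)..Suc n. F (Suc v, w))"
proof -
  have "Suc v \<in> {1..n}" using assms(2) by simp
  then have "(\<Sum>u<Suc v. F (u, Suc v)) = (\<Sum>w=Suc (Suc v)..Suc n. F (Suc v, w))"
    using assms(1) unfolding network_flows_def by blast
  then show ?thesis by (simp only: lessThan_Suc_atMost)
qed

text \<open>
  Moving the cut past one vertex exchanges the arcs entering it for those leaving it, so the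
  total flow across every cut between the source and the sink is \<open>d\<close>.
\<close>

lemma network_flow_cut:
  assumes F: "F \<in> network_flows n d" and "v \<le> n"
  shows "(\<Sum>u<Suc v. \<Sum>w=Suc v..Suc n. F (u, w)) = d"
  using assms(2)
proof (induction v)
  case 0
  then show ?case using F by (simp add: network_flows_def)
next
  case (Suc v)
  let ?R = "\<Sum>u<Suc v. \<Sum>w=Suc (Suc v)..Suc n. F (u, w)"
  have "(\<Sum>w=Suc v..Suc n. F (u, w)) = F (u, Suc v) + (\<Sum>w=Suc (Suc v)..Suc n. F (u, w))" for u
    using Suc.prems by (intro sum.atLeast_Suc_atMost) simp
  then have "d = (\<Sum>u<Suc v. F (u, Suc v)) + ?R"
    using Suc.IH Suc.prems by (simp only: sum.distrib)
  moreover have "(\<Sum>u<Suc v. F (u, Suc v)) = (\<Sum>w=Suc (Suc v)..Suc n. F (Suc v, w))"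
    using network_flow_conservation[OF F Suc.prems] by (simp only: lessThan_Suc_atMost)
  ultimately show ?case by (subst sum.lessThan_Suc) linarith
qed

text \<open>
  Bounded by the flow across a cut, the inflow leaves a non-negative slack for the superdiagonal entry.
  The last row has no superdiagonal entry, so the inflow of the sink must be exactly \<open>d\<close>.
\<close>

lemma network_flow_inflow:
  assumes F: "F \<in> network_flows n d"
  shows "v \<le> n \<Longrightarrow> (\<Sum>u\<le>v. F (u, Suc v)) \<le> d" and "(\<Sum>u\<le>n. F (u, Suc n)) = d"
proof -
  show "(\<Sum>u\<le>n. F (u, Suc n)) = d"
    using network_flow_cut[OF F, of n] by (simp add: lessThan_Suc_atMost)
  assume v: "v \<le> n"
  have "(\<Sum>u<Suc v. F (u, Suc v)) \<le> (\<Sum>u<Suc v. \<Sum>w=Suc v..Suc n. F (u, w))"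
    using v by (intro sum_mono member_le_sum) auto
  then show "(\<Sum>u\<le>v. F (u, Suc v)) \<le> d"
    using network_flow_cut[OF F v] by (simp add: lessThan_Suc_atMost)
qed

definition magic_Hessenberg :: "nat \<Rightarrow> real \<Rightarrow> real mat set" where
  "magic_Hessenberg N d = {A \<in> carrier_mat N N.
     (\<forall>i<N. \<forall>j<N. A $$ (i, j) \<ge> 0) \<and>
     (\<forall>j<N. (\<Sum>i<N. A $$ (i, j)) = d) \<and>
     (\<forall>i<N. (\<Sum>j<N. A $$ (i, j)) = d) \<and>
     (\<forall>i<N. \<forall>j<N. j > i + 1 \<longrightarrow> A $$ (i, j) = 0)}"

lemma CRY_eq_magic_Hessenberg: "CRY N = magic_Hessenberg N 1"
  by (simp add: CRY_def magic_Hessenberg_def)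

lemma smult_magic_Hessenberg:
  assumes "A \<in> magic_Hessenberg N e" and "0 \<le> c"
  shows "c \<cdot>\<^sub>m A \<in> magic_Hessenberg N (c * e)"
  using assms unfolding magic_Hessenberg_def by (auto simp: sum_distrib_left[symmetric])

text \<open>
  For \<open>d = 0\<close> the right-hand side contains only the zero matrix, which is a dilate because the polytope is
  not empty; the identity matrix is one of its points.
\<close>

lemma dilated_CRY: "(\<lambda>A. real d \<cdot>\<^sub>m A) ` CRY N = magic_Hessenberg N (real d)"
proof (intro equalityI subsetI)
  fix B assume "B \<in> (\<lambda>A. real d \<cdot>\<^sub>m A) ` CRY N"
  then show "B \<in> magic_Hessenberg N (real d)"
    using smult_magic_Hessenberg[of _ N 1 "real d"] by (auto simp: CRY_eq_magic_Hessenberg)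
next
  fix B assume B: "B \<in> magic_Hessenberg N (real d)"
  then have carrier: "B \<in> carrier_mat N N" by (simp add: magic_Hessenberg_def)
  show "B \<in> (\<lambda>A. real d \<cdot>\<^sub>m A) ` CRY N"
  proof (cases "d = 0")
    case True
    have "B $$ (i, j) = 0" if "i < N" "j < N" for i j
    proof -
      have "\<forall>j\<in>{..<N}. B $$ (i, j) = 0"
        using B that True by (subst sum_nonneg_eq_0_iff[symmetric]) (auto simp: magic_Hessenberg_def)
      then show ?thesis using that by simp
    qed
    then have "B = real d \<cdot>\<^sub>m 1\<^sub>m N" using carrier True by (intro eq_matI) auto
    moreover have "1\<^sub>m N \<in> CRY N" by (auto simp: CRY_def)
    ultimately show ?thesis by blast
  next
    case False
    then have "B = real d \<cdot>\<^sub>m (inverse (real d) \<cdot>\<^sub>m B)" using carrier by (intro eq_matI) auto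
    moreover have "inverse (real d) \<cdot>\<^sub>m B \<in> CRY N"
      using smult_magic_Hessenberg[OF B, of "inverse (real d)"] False
      by (simp add: CRY_eq_magic_Hessenberg)
    ultimately show ?thesis by blast
  qed
qed

lemma Hessenberg_row_sum:
  fixes g :: "nat \<Rightarrow> real"
  assumes "i \<le> n" and "\<And>j. j \<le> n \<Longrightarrow> i + 1 < j \<Longrightarrow> g j = 0"
  shows "(\<Sum>j<Suc n. g j) = (\<Sum>j\<le>i. g j) + (if i < n then g (Suc i) else 0)"
proof (cases "i < n")
  case True
  have "(\<Sum>j<Suc n. g j) = (\<Sum>j\<le>Suc i. g j)"
    using True assms(2) by (intro sum.mono_neutral_right) auto
  with True show ?thesis by simp
next
  case False
  with assms(1) show ?thesis by (simp add: lessThan_Suc_atMost)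
qed

lemma Hessenberg_column_sum:
  fixes h :: "nat \<Rightarrow> real"
  assumes "j \<le> n" and "\<And>i. i \<le> n \<Longrightarrow> i + 1 < j \<Longrightarrow> h i = 0"
  shows "(\<Sum>i<Suc n. h i) = (if j = 0 then 0 else h (j - 1)) + (\<Sum>i=j..n. h i)"
proof -
  have "(\<Sum>i<Suc n. h i) = (\<Sum>i=j-1..n. h i)"
    using assms(2) by (intro sum.mono_neutral_right) auto
  then show ?thesis using assms(1) by (cases j) (auto simp: sum.atLeast_Suc_atMost)
qed

text \<open>
  The entry at \<open>(i, j)\<close> with \<open>j \<le> i\<close> is the value on the arc \<open>j \<rightarrow> i + 1\<close>: column \<open>j\<close> collects what
  leaves the vertex \<open>j\<close>, and row \<open>i\<close> what enters the vertex \<open>i + 1\<close>. The superdiagonal entry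
  at \<open>(i, i + 1)\<close> lies in the row of arrivals at \<open>i + 1\<close> and in the column of departures from \<open>i + 1\<close>, so it
  can fill up both sums to \<open>d\<close> exactly when the flow is conserved there.
\<close>

definition matrix_of_flow :: "nat \<Rightarrow> nat \<Rightarrow> (nat \<times> nat \<Rightarrow> nat) \<Rightarrow> real mat" where
  "matrix_of_flow n d F = mat (Suc n) (Suc n) (\<lambda>(i, j).
     if j \<le> i then real (F (j, Suc i))
     else if j = Suc i then real d - real (\<Sum>u\<le>i. F (u, Suc i)) else 0)"

definition flow_of_matrix :: "nat \<Rightarrow> real mat \<Rightarrow> nat \<times> nat \<Rightarrow> nat" where
  "flow_of_matrix n B = (\<lambda>(u, v). if u < v \<and> v \<le> Suc n then nat \<lfloor>B $$ (v - 1, u)\<rfloor> else 0)"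

lemma elements_mat_subset_Ints_iff:
  "B \<in> carrier_mat N N \<Longrightarrow> elements_mat B \<subseteq> \<int> \<longleftrightarrow> (\<forall>i<N. \<forall>j<N. B $$ (i, j) \<in> \<int>)"
  by (fastforce simp: elements_mat_def)

lemma matrix_of_flow_in:
  assumes F: "F \<in> network_flows n d"
  shows "matrix_of_flow n d F \<in> {B \<in> magic_Hessenberg (Suc n) (real d). elements_mat B \<subseteq> \<int>}"
proof -
  let ?B = "matrix_of_flow n d F"
  have dim: "?B \<in> carrier_mat (Suc n) (Suc n)" by (simp add: matrix_of_flow_def)
  have entry: "?B $$ (i, j) = (if j \<le> i then real (F (j, Suc i))
     else if j = Suc i then real d - real (\<Sum>u\<le>i. F (u, Suc i)) else 0)" if "i \<le> n" "j \<le> n" for i j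
    using that by (simp add: matrix_of_flow_def)
  have nonneg: "?B $$ (i, j) \<ge> 0" if "i \<le> n" "j \<le> n" for i j
    using network_flow_inflow(1)[OF F that(1)] by (simp add: entry[OF that] del: of_nat_sum)
  have int: "?B $$ (i, j) \<in> \<int>" if "i \<le> n" "j \<le> n" for i j
    by (simp add: entry[OF that] del: of_nat_sum)
  have row: "(\<Sum>j<Suc n. ?B $$ (i, j)) = real d" if i: "i \<le> n" for i
  proof -
    have "(\<Sum>j<Suc n. ?B $$ (i, j)) = (\<Sum>j\<le>i. ?B $$ (i, j)) + (if i < n then ?B $$ (i, Suc i) else 0)"
      using i by (intro Hessenberg_row_sum) (auto simp: entry)
    also have "(\<Sum>j\<le>i. ?B $$ (i, j)) = real (\<Sum>u\<le>i. F (u, Suc i))"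
      using i by (simp add: entry)
    finally show ?thesis
      using i network_flow_inflow(2)[OF F] by (cases "i = n") (auto simp: entry)
  qed
  have col: "(\<Sum>i<Suc n. ?B $$ (i, j)) = real d" if j: "j \<le> n" for j
  proof -
    have "(\<Sum>i<Suc n. ?B $$ (i, j)) = (if j = 0 then 0 else ?B $$ (j - 1, j)) + (\<Sum>i=j..n. ?B $$ (i, j))"
      using j by (intro Hessenberg_column_sum) (auto simp: entry)
    also have "(\<Sum>i=j..n. ?B $$ (i, j)) = (\<Sum>i=j..n. real (F (j, Suc i)))"
      using j by (intro sum.cong) (auto simp: entry)
    also have "\<dots> = real (\<Sum>w=Suc j..Suc n. F (j, w))"
      by (simp only: sum.shift_bounds_cl_Suc_ivl of_nat_sum)
    finally have *: "(\<Sum>i<Suc n. ?B $$ (i, j))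
      = (if j = 0 then 0 else ?B $$ (j - 1, j)) + real (\<Sum>w=Suc j..Suc n. F (j, w))" .
    show ?thesis
    proof (cases j)
      case 0
      then show ?thesis using * F by (simp add: network_flows_def del: sum.cl_ivl_Suc of_nat_sum)
    next
      case (Suc i)
      have "(\<Sum>u\<le>i. F (u, Suc i)) = (\<Sum>w=Suc j..Suc n. F (j, w))"
        using network_flow_conservation[OF F] j Suc by simp
      then show ?thesis
        using * j Suc by (simp add: entry del: sum.cl_ivl_Suc)
    qed
  qed
  show ?thesis
    using dim nonneg row col int
    by (auto simp: magic_Hessenberg_def elements_mat_subset_Ints_iff less_Suc_eq_le entry)
qed

lemma flow_of_matrix_in:
  assumes B: "B \<in> magic_Hessenberg (Suc n) (real d)" and int: "elements_mat B \<subseteq> \<int>"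
  shows "flow_of_matrix n B \<in> network_flows n d"
    and "matrix_of_flow n d (flow_of_matrix n B) = B"
proof -
  let ?F = "flow_of_matrix n B"
  have dim: "B \<in> carrier_mat (Suc n) (Suc n)" using B by (simp add: magic_Hessenberg_def)
  have F: "real (?F (j, Suc i)) = B $$ (i, j)" if "i \<le> n" "j \<le> i" for i j
  proof -
    have "B $$ (i, j) \<in> \<int>" using int that by (simp add: elements_mat_subset_Ints_iff[OF dim])
    moreover have "B $$ (i, j) \<ge> 0" using B that by (simp add: magic_Hessenberg_def)
    ultimately show ?thesis
      using that by (auto simp: flow_of_matrix_def elim!: Ints_cases)
  qed
  have row: "real d = real (\<Sum>u\<le>i. ?F (u, Suc i)) + (if i < n then B $$ (i, Suc i) else 0)"
    if i: "i \<le> n" for i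
  proof -
    have "real d = (\<Sum>j<Suc n. B $$ (i, j))" using B i by (simp add: magic_Hessenberg_def)
    also have "\<dots> = (\<Sum>j\<le>i. B $$ (i, j)) + (if i < n then B $$ (i, Suc i) else 0)"
      using B i by (intro Hessenberg_row_sum) (auto simp: magic_Hessenberg_def)
    finally show ?thesis using i by (simp add: F)
  qed
  have col: "real d = (if j = 0 then 0 else B $$ (j - 1, j)) + real (\<Sum>w=Suc j..Suc n. ?F (j, w))"
    if j: "j \<le> n" for j
  proof -
    have "real d = (\<Sum>i<Suc n. B $$ (i, j))" using B j by (simp add: magic_Hessenberg_def)
    also have "\<dots> = (if j = 0 then 0 else B $$ (j - 1, j)) + (\<Sum>i=j..n. B $$ (i, j))"
      using B j by (intro Hessenberg_column_sum) (auto simp: magic_Hessenberg_def)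
    also have "(\<Sum>i=j..n. B $$ (i, j)) = real (\<Sum>w=Suc j..Suc n. ?F (j, w))"
      unfolding sum.shift_bounds_cl_Suc_ivl of_nat_sum by (intro sum.cong) (auto simp: F)
    finally show ?thesis .
  qed
  have "(\<Sum>u<v. ?F (u, v)) = (\<Sum>w=Suc v..Suc n. ?F (v, w))" if v: "v \<in> {1..n}" for v
  proof -
    obtain i where i: "v = Suc i" "i < n" using v by (cases v) auto
    have "real (\<Sum>u\<le>i. ?F (u, Suc i)) = real (\<Sum>w=Suc v..Suc n. ?F (v, w))"
      using row[of i] col[of v] i by simp
    then show ?thesis unfolding of_nat_eq_iff by (simp only: i(1) lessThan_Suc_atMost)
  qed
  moreover have "real (\<Sum>w=Suc 0..Suc n. ?F (0, w)) = real d"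
    using col[of 0] by simp
  then have "(\<Sum>w=Suc 0..Suc n. ?F (0, w)) = d"
    unfolding of_nat_eq_iff .
  ultimately show "?F \<in> network_flows n d"
    by (auto simp: network_flows_def flow_of_matrix_def)
  show "matrix_of_flow n d ?F = B"
  proof (rule eq_matI)
    fix i j assume "i < dim_row B" "j < dim_col B"
    with dim have ij: "i \<le> n" "j \<le> n" by auto
    show "matrix_of_flow n d ?F $$ (i, j) = B $$ (i, j)"
    proof (cases "j \<le> i")
      case True
      then show ?thesis using ij F by (simp add: matrix_of_flow_def)
    next
      case False
      show ?thesis
      proof (cases "j = Suc i")
        case True
        with ij row[of i] show ?thesis by (simp add: matrix_of_flow_def)
      next
        case False
        with \<open>\<not> j \<le> i\<close> ij B show ?thesis
          by (simp add: matrix_of_flow_def magic_Hessenberg_def)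
      qed
    qed
  qed (use dim in \<open>auto simp: matrix_of_flow_def\<close>)
qed

lemma ehrhart_count_CRY: "ehrhart_count (CRY (Suc n)) d = card (network_flows n d)"
proof -
  have "bij_betw (matrix_of_flow n d) (network_flows n d)
    {B \<in> magic_Hessenberg (Suc n) (real d). elements_mat B \<subseteq> \<int>}"
  proof (rule bij_betw_byWitness[where f' = "flow_of_matrix n"])
    show "\<forall>F\<in>network_flows n d. flow_of_matrix n (matrix_of_flow n d F) = F"
    proof
      fix F assume F: "F \<in> network_flows n d"
      have "flow_of_matrix n (matrix_of_flow n d F) (u, v) = F (u, v)" for u v
        using F by (cases v) (auto simp: flow_of_matrix_def matrix_of_flow_def network_flows_def)
      then show "flow_of_matrix n (matrix_of_flow n d F) = F" by (simp add: fun_eq_iff)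
    qed
  qed (use flow_of_matrix_in matrix_of_flow_in in blast)+
  then show ?thesis
    unfolding ehrhart_count_def dilated_CRY by (simp add: bij_betw_same_card)
qed

text \<open>
  The free numbers attached to the vertices \<open>0, \<dots>, n\<close> account for the power of \<open>1 - X\<close>.
\<close>

lemma ehrhart_series_CRY:
  "Abs_fps (\<lambda>d. int (ehrhart_count (CRY (Suc n)) d)) * (1 - fps_X) ^ Suc n
    = flow_series n (complete_monom n)"
proof -
  let ?m = "complete_monom n"
  have "Abs_fps (\<lambda>d. int (ehrhart_count (CRY (Suc n)) d))
    = weight_series (flows ?m \<times> supported_on {0..n}) (\<lambda>(f, r). excess n (net f) + (\<Sum>v\<in>{0..n}. r v))"
    unfolding weight_series_def ehrhart_count_CRY card_network_flows[symmetric]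
    by simp
  then show ?thesis
    using weight_series_prod_supported_on[OF finite_fibres_flows[of ?m n], of "{0..n}"]
    by (simp add: flow_series_def keys_complete_monom)
qed

theorem theorem5p12:
  fixes n :: nat
  assumes "n \<ge> 2"
  shows "(\<exists>q. reduced_polynomial_of (w0 n) q) \<and>
    (\<forall>q. reduced_polynomial_of (w0 n) q \<longrightarrow>
      fps_of_poly (pcompose (eval_xpoly (\<lambda>_. 1) q) [:-1, 1:]) =
        Abs_fps (\<lambda>m. int (ehrhart_count (CRY (n + 1)) m))
          * (1 - fps_X) ^ (((n + 1) choose 2) + 1))"
proof (intro conjI allI impI)
  have within: "monomials_within n (w0 n)"
    by (simp add: monomials_within_def w0_eq_single keys_complete_monom)
  then show "\<exists>q. reduced_polynomial_of (w0 n) q" by (rule exists_reduced_polynomial)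
  fix q assume "reduced_polynomial_of (w0 n) q"
  then have steps: "reduction_step\<^sup>*\<^sup>* (w0 n) q" and reduced: "is_reduced q"
    by (auto simp: reduced_polynomial_of_def)
  have "shift_beta (eval_xpoly (\<lambda>_. 1) q) = polynomial_series n (w0 n)"
    using reductions_invariant[OF steps within] polynomial_series_reduced[OF _ reduced] by metis
  also have "\<dots> = flow_series n (complete_monom n) * (1 - fps_X) ^ (n choose 2)"
    by (simp add: w0_eq_single polynomial_series_single weighted_flow_series_def
        labels_complete_monom card_cartesian_product card_arcs)
  also have "\<dots> = Abs_fps (\<lambda>m. int (ehrhart_count (CRY (Suc n)) m)) * (1 - fps_X) ^ (Suc n + (n choose 2))"
    unfolding ehrhart_series_CRY[symmetric] power_add by (simp only: mult.assoc)
  also have "Suc n + (n choose 2) = ((n + 1) choose 2) + 1"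
    by (simp add: numeral_2_eq_2)
  finally show "fps_of_poly (pcompose (eval_xpoly (\<lambda>_. 1) q) [:-1, 1:]) =
        Abs_fps (\<lambda>m. int (ehrhart_count (CRY (n + 1)) m))
          * (1 - fps_X) ^ (((n + 1) choose 2) + 1)"
    by (simp add: shift_beta_def)
qed

end
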